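(* The set \[ \bigg\{ \Big(\sum_{n\in A}\frac{1}{n},\ \sum_{n\in A}\frac{1}{n+1},\ \sum_{n\in A}\frac{1}{n+2}\Big) \,:\, A\subset\mathbb{N} \text{ is an infinite set with } \sum_{n\in A}\frac{1}{n}<\infty \bigg\} \subseteq \mathbb{R}^3 \] has a non-empty interior (in the usual Euclidean topology of $\mathbb{R}^3$).
   Context: $\mathbb{N}$ denotes the set of all positive integers. *)

theory Defs
  imports "HOL-Analysis.Analysis"
begin

end

theory Submission
  imports Defs
begin

text \<open>
  The three sums are an invertible linear image of the sums
  \<open>z i = (\<Sum>n\<in>A. 1 / (n \<cdots> (n + i - 1)))\<close>, \<open>i = 1, 2, 3\<close>, so it is enough that every
  triple in some open box arises as such a \<open>z\<close>. In these coordinates an integer \<open>n\<close> contributes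
  roughly \<open>(1/n, 1/n\<^sup>2, 1/n\<^sup>3)\<close>: for \<open>n \<approx> M / t\<close>, after multiplying the \<open>i\<close>-th coordinate by
  \<open>M ^ i\<close>, it contributes \<open>(t, t\<^sup>2, t\<^sup>3)\<close> up to an error \<open>O(1/M)\<close> that comes from rounding and
  from the shifts in the denominators.

  A block of three integers at scale \<open>M\<close> thus realises, up to \<open>O(1/M)\<close>, any triple of power sums
  of three reals \<open>t\<^sub>1, t\<^sub>2, t\<^sub>3\<close> near \<open>1, 2, 3\<close>. These triples fill a neighbourhood of
  \<open>(6, 14, 36)\<close>: power sums determine the coefficients of the cubic with roots \<open>t\<^sub>j\<close>, and a
  small change of the coefficients of \<open>(X - 1)(X - 2)(X - 3)\<close> preserves its sign changes
  (\<open>power_sums_near_123\<close>).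

  The set \<open>A\<close> is a union of such blocks at the scales \<open>M\<^sub>k = 10\<^bsup>10\<^esup> \<cdot> 8\<^bsup>k\<^esup>\<close>. The box used at
  scale \<open>M\<close> has centre \<open>box_centre i / M ^ i\<close> and half-widths \<open>1 / (1000 M ^ i)\<close>. Its centre is
  what infinitely many unperturbed blocks contribute, so subtracting one block leads from the
  centre of one box to the centre of the next. A point of the box at scale \<open>M\<close> can therefore be
  moved by one block not just into the box at scale \<open>8 M\<close>, but to its centre up to the error
  \<open>O(1/M)\<close>, which is far below the width of that box (\<open>block_step\<close>). Iterating, the remainders
  tend to \<open>0\<close>, and the starting point is the sum over all blocks (\<open>box_attained\<close>).
\<close>

section \<open>Prescribing three power sums\<close>

definition base_power_sum :: "nat \<Rightarrow> real" where
  "base_power_sum i = (\<Sum>j\<in>{1..3}. real j ^ i)"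

text \<open>
  The \<open>i\<close>-th coordinate of the geometric series \<open>(\<Sum>k. base_power_sum i / 8 ^ (k * i))\<close>: the
  contribution of unperturbed blocks at the scales \<open>1, 8, 64, \<dots>\<close>.
\<close>

definition box_centre :: "nat \<Rightarrow> real" where
  "box_centre i = base_power_sum i * 8 ^ i / (8 ^ i - 1)"

lemma atLeastAtMost_1_3: "{1..3::nat} = {1, 2, 3}"
  by auto

lemma box_centre_self_similar:
  assumes "i \<in> {1..3}"
  shows "box_centre i = base_power_sum i + box_centre i / 8 ^ i"
  using assms unfolding atLeastAtMost_1_3 box_centre_def by auto

lemma vieta_three_roots:
  fixes a b c r s t :: real
  assumes r: "r ^ 3 - a * r ^ 2 + b * r - c = 0"
    and s: "s ^ 3 - a * s ^ 2 + b * s - c = 0"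
    and t: "t ^ 3 - a * t ^ 2 + b * t - c = 0"
    and distinct: "r \<noteq> s" "s \<noteq> t" "r \<noteq> t"
  shows "a = r + s + t" "b = r * s + s * t + r * t" "c = r * s * t"
proof -
  have "(r - s) * (r\<^sup>2 + r * s + s\<^sup>2 - a * (r + s) + b) = 0"
    using r s by algebra
  then have rs: "r\<^sup>2 + r * s + s\<^sup>2 - a * (r + s) + b = 0"
    using distinct by simp
  have "(s - t) * (s\<^sup>2 + s * t + t\<^sup>2 - a * (s + t) + b) = 0"
    using s t by algebra
  then have st: "s\<^sup>2 + s * t + t\<^sup>2 - a * (s + t) + b = 0"
    using distinct by simp
  have "(r - t) * (r + s + t - a) = 0"
    using rs st by algebra
  then show a: "a = r + s + t"
    using distinct by simp
  then show b: "b = r * s + s * t + r * t"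
    using rs by algebra
  show "c = r * s * t"
    using r a b by algebra
qed

text \<open>
  Newton's identities turn the prescribed power sums into the coefficients of a monic cubic. It is
  so close to \<open>(X - 1)(X - 2)(X - 3)\<close> that it still changes sign on each interval
  \<open>[j - 1/4, j + 1/4]\<close>; the three roots found there have the required power sums by Vieta.
\<close>

lemma power_sums_near_123:
  fixes u :: "nat \<Rightarrow> real"
  assumes u: "\<And>i. i \<in> {1..3} \<Longrightarrow> \<bar>u i - base_power_sum i\<bar> \<le> 1 / 1000"
  obtains t :: "nat \<Rightarrow> real"
  where "\<And>j. j \<in> {1..3} \<Longrightarrow> \<bar>t j - real j\<bar> \<le> 1 / 4"
    and "\<And>i. i \<in> {1..3} \<Longrightarrow> (\<Sum>j\<in>{1..3}. t j ^ i) = u i"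
proof -
  define x where "x = u 1 - 6"
  define y where "y = u 2 - 14"
  define z where "z = u 3 - 36"
  have small: "\<bar>x\<bar> \<le> 1 / 1000" "\<bar>y\<bar> \<le> 1 / 1000" "\<bar>z\<bar> \<le> 1 / 1000"
    using u[of 1] u[of 2] u[of 3]
    unfolding x_def y_def z_def base_power_sum_def atLeastAtMost_1_3 by simp_all
  have x2: "\<bar>x\<^sup>2\<bar> \<le> 1 / 1000" and xy: "\<bar>x * y\<bar> \<le> 1 / 1000"
    using mult_mono[OF small(1) small(1)] mult_mono[OF small(1) small(2)]
    by (simp_all add: power2_eq_square abs_mult)
  have x3: "\<bar>x ^ 3\<bar> \<le> 1 / 1000"
    using mult_mono[OF small(1) x2] by (simp add: power3_eq_cube power2_eq_square abs_mult)
  \<comment> \<open>The elementary symmetric functions of the roots, by Newton's identities.\<close>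
  define a where "a = u 1"
  define b where "b = ((u 1)\<^sup>2 - u 2) / 2"
  define c where "c = ((u 1) ^ 3 - 3 * u 1 * u 2 + 2 * u 3) / 6"
  define f where "f X = X ^ 3 - a * X ^ 2 + b * X - c" for X
  \<comment> \<open>The unperturbed cubic is at least \<open>15/64\<close> in absolute value at the six endpoints.\<close>
  have f: "f X = (X - 1) * (X - 2) * (X - 3) - x * X\<^sup>2 + (6 * x + x\<^sup>2 / 2 - y / 2) * X
      - (11 * x + 3 * x\<^sup>2 + x ^ 3 / 6 - 3 * y - x * y / 2 + z / 3)" for X
  proof -
    have "u 1 = x + 6" "u 2 = y + 14" "u 3 = z + 36"
      by (simp_all add: x_def y_def z_def)
    then show ?thesis
      unfolding f_def a_def b_def c_def
      by (simp add: field_simps power2_eq_square power3_eq_cube)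
  qed
  have signs: "f (3/4) \<le> 0" "0 \<le> f (5/4)" "0 \<le> f (7/4)" "f (9/4) \<le> 0" "f (11/4) \<le> 0" "0 \<le> f (13/4)"
    using small x2 xy x3 unfolding f abs_le_iff
    by (simp_all add: field_simps power2_eq_square[of "numeral _"])
  have cont: "continuous_on A f" for A
    unfolding f_def by (intro continuous_intros)
  obtain r where r: "3/4 \<le> r" "r \<le> 5/4" "f r = 0"
    using IVT'[of f "3/4" 0 "5/4"] signs cont by auto
  obtain s where s: "7/4 \<le> s" "s \<le> 9/4" "f s = 0"
    using IVT2'[of f "9/4" 0 "7/4"] signs cont by auto
  obtain t where t: "11/4 \<le> t" "t \<le> 13/4" "f t = 0"
    using IVT'[of f "11/4" 0 "13/4"] signs cont by auto
  have neq: "r \<noteq> s" "s \<noteq> t" "r \<noteq> t"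
    using r s t by auto
  note vieta = vieta_three_roots[OF r(3)[unfolded f_def] s(3)[unfolded f_def] t(3)[unfolded f_def] neq]
  have u1: "r + s + t = u 1"
    using vieta(1) by (simp add: a_def)
  have u2: "r\<^sup>2 + s\<^sup>2 + t\<^sup>2 = u 2"
  proof -
    have "u 2 = (u 1)\<^sup>2 - 2 * b" by (simp add: b_def field_simps)
    then show ?thesis unfolding u1[symmetric] vieta(2) by algebra
  qed
  have u3: "r ^ 3 + s ^ 3 + t ^ 3 = u 3"
  proof -
    have "2 * u 3 = 6 * c - (u 1) ^ 3 + 3 * u 1 * u 2" by (simp add: c_def field_simps)
    then show ?thesis unfolding u1[symmetric] u2[symmetric] vieta(3) by algebra
  qed
  have dist: "\<bar>r - 1\<bar> \<le> 1 / 4" "\<bar>s - 2\<bar> \<le> 1 / 4" "\<bar>t - 3\<bar> \<le> 1 / 4"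
    using r s t by linarith+
  show thesis
  proof (rule that[of "\<lambda>j. if j = 1 then r else if j = 2 then s else t"])
    show "\<bar>(if j = 1 then r else if j = 2 then s else t) - real j\<bar> \<le> 1 / 4" if "j \<in> {1..3}" for j
      using that dist unfolding atLeastAtMost_1_3 by auto
    show "(\<Sum>j\<in>{1..3::nat}. (if j = 1 then r else if j = 2 then s else t) ^ i) = u i" if "i \<in> {1..3}" for i
      using that u1 u2 u3 unfolding atLeastAtMost_1_3 by (auto simp: add_ac)
  qed
qed

section \<open>One block of three integers\<close>

text \<open>
  Each factor \<open>M / (n + j)\<close> of \<open>M ^ i / pochhammer n i\<close> differs from \<open>t\<close> by \<open>O(1/M)\<close>, and a
  product of at most three bounded factors inherits this error.
\<close>

lemma round_reciprocal:
  fixes M t :: real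
  assumes M: "M \<ge> 10 ^ 10" and t: "3/4 \<le> t" "t \<le> 13/4"
  defines "n \<equiv> nat \<lfloor>M / t\<rfloor>"
  shows "M / t - 1 < real n" "real n \<le> M / t" "M / 4 < real n" "real n \<le> 2 * M"
    and "i \<in> {1..3} \<Longrightarrow> \<bar>M ^ i / pochhammer (real n) i - t ^ i\<bar> \<le> 1300 / M"
proof -
  have Mt: "0 \<le> M / t" using M t by simp
  show lo: "M / t - 1 < real n" and hi: "real n \<le> M / t"
    using Mt by (simp_all add: n_def)
  have "M / (13/4) \<le> M / t" using M t by (intro divide_left_mono) auto
  then show n: "M / 4 < real n" using lo M by simp
  have "M / t \<le> M / (3/4)" using M t by (intro divide_left_mono) auto
  also have "\<dots> = 4/3 * M" by simp
  finally show "real n \<le> 2 * M" using hi M by linarith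
  \<comment> \<open>\<open>|M - t (n + j)| \<le> 2 t \<le> 13/2\<close> and \<open>n > M / 4\<close>, hence the bound \<open>4 \<cdot> 13/2 / M\<close>.\<close>
  define e where "e = 26 / M"
  have e0: "0 \<le> e" using M by (simp add: e_def)
  have near: "\<bar>M / (real n + j) - t\<bar> \<le> e" if j: "0 \<le> j" "j \<le> 2" for j
  proof -
    have pos: "0 < real n + j" using n M j by simp
    have "M < t * real n + t" "t * real n \<le> M"
      using lo hi t by (simp_all add: field_simps)
    moreover have "0 \<le> t * j" "t * j \<le> t * 2" using t j by (auto intro: mult_left_mono)
    moreover have "M - t * (real n + j) = M - t * real n - t * j" by algebra
    ultimately have "\<bar>M - t * (real n + j)\<bar> \<le> 2 * t"
      using t by linarith
    also have "\<dots> \<le> 13 / 2" using t by simp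
    also have "\<dots> \<le> e * (real n + j)"
      using n j M by (simp add: e_def field_simps)
    finally have "\<bar>M - t * (real n + j)\<bar> \<le> e * (real n + j)" .
    moreover have "M / (real n + j) - t = (M - t * (real n + j)) / (real n + j)"
      using pos by (simp add: field_simps)
    ultimately show ?thesis using pos by (simp add: abs_divide pos_divide_le_eq)
  qed
  define x y w where "x = M / real n" and "y = M / (real n + 1)" and "w = M / (real n + 2)"
  have d: "\<bar>x - t\<bar> \<le> e" "\<bar>y - t\<bar> \<le> e" "\<bar>w - t\<bar> \<le> e"
    using near[of 0] near[of 1] near[of 2] by (simp_all add: x_def y_def w_def)
  have le4: "\<bar>x\<bar> \<le> 4" "\<bar>y\<bar> \<le> 4" "\<bar>t\<bar> \<le> 4"
    using n M t by (simp_all add: x_def y_def field_simps)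
  have d2: "\<bar>x * y - t\<^sup>2\<bar> \<le> 8 * e"
  proof -
    have "x * y - t\<^sup>2 = x * (y - t) + t * (x - t)" by algebra
    then have "\<bar>x * y - t\<^sup>2\<bar> \<le> \<bar>x\<bar> * \<bar>y - t\<bar> + \<bar>t\<bar> * \<bar>x - t\<bar>"
      by (metis abs_mult abs_triangle_ineq)
    also have "\<dots> \<le> 4 * e + 4 * e" by (intro add_mono mult_mono le4 d) auto
    finally show ?thesis by simp
  qed
  have d3: "\<bar>x * y * w - t ^ 3\<bar> \<le> 48 * e"
  proof -
    have "x * y * w - t ^ 3 = (x * y) * (w - t) + t * (x * y - t\<^sup>2)" by algebra
    then have "\<bar>x * y * w - t ^ 3\<bar> \<le> \<bar>x\<bar> * \<bar>y\<bar> * \<bar>w - t\<bar> + \<bar>t\<bar> * \<bar>x * y - t\<^sup>2\<bar>"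
      by (metis abs_mult abs_triangle_ineq)
    also have "\<dots> \<le> 4 * 4 * e + 4 * (8 * e)" by (intro add_mono mult_mono le4 d d2) auto
    finally show ?thesis by simp
  qed
  have prods: "M ^ 1 / pochhammer (real n) 1 = x" "M ^ 2 / pochhammer (real n) 2 = x * y"
    "M ^ 3 / pochhammer (real n) 3 = x * y * w"
    by (simp_all add: x_def y_def w_def eval_nat_numeral pochhammer_Suc)
  assume "i \<in> {1..3}"
  then consider "i = 1" | "i = 2" | "i = 3" unfolding atLeastAtMost_1_3 by blast
  then have "\<bar>M ^ i / pochhammer (real n) i - t ^ i\<bar> \<le> 48 * e"
  proof cases
    case 1
    then show ?thesis unfolding 1 prods using d(1) e0 by simp
  next
    case 2
    then show ?thesis unfolding 2 prods using d2 e0 by simp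
  next
    case 3
    then show ?thesis unfolding 3 prods using d3 by simp
  qed
  also have "\<dots> \<le> 1300 / M" using M by (simp add: e_def field_simps)
  finally show "\<bar>M ^ i / pochhammer (real n) i - t ^ i\<bar> \<le> 1300 / M" .
qed

text \<open>
  The self-similarity of the box centres makes \<open>z i * M ^ i - box_centre i / 8 ^ i\<close> a small
  perturbation of \<open>base_power_sum i\<close>, so it is an exact triple of power sums of reals \<open>t j\<close>.
  Rounding each \<open>M / t j\<close> to an integer costs at most \<open>8\<^sup>3 \<cdot> 3 \<cdot> 1300 / M\<close> at the next scale,
  which is below \<open>1/1000\<close>.
\<close>

lemma block_step:
  fixes M :: real and z :: "nat \<Rightarrow> real"
  assumes M: "M \<ge> 10 ^ 10"
    and z: "\<And>i. i \<in> {1..3} \<Longrightarrow> \<bar>z i * M ^ i - box_centre i\<bar> \<le> 1 / 1000"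
  obtains S :: "nat set"
  where "finite S" "S \<noteq> {}" "\<And>n. n \<in> S \<Longrightarrow> M / 4 < real n \<and> real n \<le> 2 * M"
    and "\<And>i. i \<in> {1..3} \<Longrightarrow>
      \<bar>(z i - (\<Sum>n\<in>S. 1 / pochhammer (real n) i)) * (8 * M) ^ i - box_centre i\<bar> \<le> 1 / 1000"
proof -
  define u where "u i = z i * M ^ i - box_centre i / 8 ^ i" for i
  have "\<bar>u i - base_power_sum i\<bar> \<le> 1 / 1000" if "i \<in> {1..3}" for i
    using z[OF that] box_centre_self_similar[OF that] by (simp add: u_def algebra_simps)
  then obtain t where t: "\<And>j. j \<in> {1..3} \<Longrightarrow> \<bar>t j - real j\<bar> \<le> 1 / 4"
    and sums: "\<And>i. i \<in> {1..3} \<Longrightarrow> (\<Sum>j\<in>{1..3}. t j ^ i) = u i"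
    using power_sums_near_123[of u] by auto
  define n where "n j = nat \<lfloor>M / t j\<rfloor>" for j
  have range: "3/4 \<le> t j" "t j \<le> 13/4" if "j \<in> {1..3}" for j
  proof -
    have "1 \<le> real j" "real j \<le> 3" using that by auto
    with t[OF that] show "3/4 \<le> t j" "t j \<le> 13/4" by linarith+
  qed
  note round = round_reciprocal[OF M range, folded n_def]
  \<comment> \<open>Distinct \<open>t j\<close> are at least \<open>1/2\<close> apart, so rounding keeps the three integers distinct.\<close>
  have sep: "n k < n j" if jk: "j \<in> {1..3}" "k \<in> {1..3}" "j < k" for j k
  proof -
    have gap: "t j + 1/2 \<le> t k"
      using t[OF jk(1)] t[OF jk(2)] jk(3) by linarith
    have "t j * t k \<le> (13/4) * (13/4)"
      using range[OF jk(1)] range[OF jk(2)] by (intro mult_mono) linarith+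
    then have "1 < M * (1/2) / (t j * t k)"
      using M range[OF jk(1)] range[OF jk(2)] by (simp add: less_divide_eq)
    also have "\<dots> \<le> M * (t k - t j) / (t j * t k)"
      using M gap range[OF jk(1)] range[OF jk(2)] by (intro divide_right_mono mult_left_mono) auto
    also have "\<dots> = M / t j - M / t k"
      using range[OF jk(1)] range[OF jk(2)] by (simp add: field_simps)
    finally show ?thesis
      using round(1)[OF jk(1) jk(1)] round(2)[OF jk(2) jk(2)] by linarith
  qed
  have inj: "inj_on n {1..3}"
    by (rule linorder_inj_onI') (use sep in force)
  show thesis
  proof (rule that[of "n ` {1..3}"])
    fix i :: nat assume i: "i \<in> {1..3}"
    have "M ^ i * (\<Sum>m\<in>n ` {1..3}. 1 / pochhammer (real m) i) = (\<Sum>j\<in>{1..3}. M ^ i / pochhammer (real (n j)) i)"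
      unfolding sum.reindex[OF inj] sum_distrib_left by simp
    then have "(z i - (\<Sum>m\<in>n ` {1..3}. 1 / pochhammer (real m) i)) * (8 * M) ^ i - box_centre i
        = 8 ^ i * (u i - (\<Sum>j\<in>{1..3}. M ^ i / pochhammer (real (n j)) i))"
      by (simp add: u_def power_mult_distrib algebra_simps)
    also have "\<dots> = - (8 ^ i * (\<Sum>j\<in>{1..3}. M ^ i / pochhammer (real (n j)) i - t j ^ i))"
      by (simp add: sums[OF i, symmetric] sum_subtractf algebra_simps)
    finally have "\<bar>(z i - (\<Sum>m\<in>n ` {1..3}. 1 / pochhammer (real m) i)) * (8 * M) ^ i - box_centre i\<bar>
        = 8 ^ i * \<bar>\<Sum>j\<in>{1..3}. M ^ i / pochhammer (real (n j)) i - t j ^ i\<bar>"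
      by (simp add: abs_mult)
    also have "\<dots> \<le> 8 ^ 3 * (\<Sum>j\<in>{1..3::nat}. 1300 / M)"
      using i by (intro mult_mono power_increasing order_trans[OF sum_abs] sum_mono round(5)) auto
    also have "\<dots> \<le> 1 / 1000"
      using M by (simp add: field_simps)
    finally show "\<bar>(z i - (\<Sum>m\<in>n ` {1..3}. 1 / pochhammer (real m) i)) * (8 * M) ^ i - box_centre i\<bar> \<le> 1 / 1000" .
  qed (use round(3,4) in auto)
qed

section \<open>Summing over all blocks\<close>

lemma has_sum_nonneg_exhaustion:
  fixes f :: "'a \<Rightarrow> real"
  assumes nonneg: "\<And>x. x \<in> (\<Union>k. F k) \<Longrightarrow> 0 \<le> f x"
    and fin: "\<And>k. finite (F k)" and mono: "incseq F"
    and lim: "(\<lambda>k::nat. sum f (F k)) \<longlonglongrightarrow> s"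
  shows "(f has_sum s) (\<Union>k. F k)"
proof -
  have cofinal: "\<exists>k. X \<subseteq> F k" if "finite X" "X \<subseteq> (\<Union>k. F k)" for X
    using that
  proof (induction X)
    case (insert x X)
    then obtain k l where "X \<subseteq> F k" "x \<in> F l" by auto
    then have "insert x X \<subseteq> F (max k l)"
      using monoD[OF mono, of k "max k l"] monoD[OF mono, of l "max k l"] by auto
    then show ?case ..
  qed simp
  have "incseq (\<lambda>k. sum f (F k))"
    using mono nonneg by (intro monoI sum_mono2) (auto simp: fin dest: monoD)
  from incseq_le[OF this lim] have le: "sum f (F k) \<le> s" for k .
  have "f summable_on (\<Union>k. F k)"
  proof (rule nonneg_bdd_above_summable_on)
    show "bdd_above (sum f ` {X. X \<subseteq> (\<Union>k. F k) \<and> finite X})"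
    proof (rule bdd_aboveI2)
      fix X assume "X \<in> {X. X \<subseteq> (\<Union>k. F k) \<and> finite X}"
      then obtain k where "X \<subseteq> F k" using cofinal[of X] by auto
      then have "sum f X \<le> sum f (F k)"
        using nonneg by (intro sum_mono2 fin) auto
      with le[of k] show "sum f X \<le> s" by simp
    qed
  qed (use nonneg in auto)
  then have sum: "(f has_sum infsum f (\<Union>k. F k)) (\<Union>k. F k)" by simp
  have "filterlim F (finite_subsets_at_top (\<Union>k. F k)) sequentially"
    unfolding filterlim_finite_subsets_at_top
  proof (intro allI impI)
    fix X assume "finite X \<and> X \<subseteq> (\<Union>k. F k)"
    then obtain k where "X \<subseteq> F k" using cofinal[of X] by auto
    then have "X \<subseteq> F l" if "l \<ge> k" for l
      using monoD[OF mono that] by auto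
    then show "\<forall>\<^sub>F l in sequentially. finite (F l) \<and> X \<subseteq> F l \<and> F l \<subseteq> (\<Union>k. F k)"
      using fin by (intro eventually_sequentiallyI[of k]) auto
  qed
  from filterlim_compose[OF sum[unfolded has_sum_def] this]
  have "(\<lambda>k. sum f (F k)) \<longlonglongrightarrow> infsum f (\<Union>k. F k)" .
  with lim sum show ?thesis using LIMSEQ_unique by blast
qed

text \<open>
  The remainder after \<open>k\<close> blocks lies in the box at scale \<open>M\<^sub>k\<close>, and these boxes shrink to the
  origin. Consecutive blocks lie in the disjoint intervals \<open>(M\<^sub>k / 4, M\<^bsub>k+1\<^esub> / 4]\<close>, because
  \<open>2 M\<^sub>k = M\<^bsub>k+1\<^esub> / 4\<close>; hence no integer is used twice.
\<close>

lemma box_attained: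
  fixes z :: "nat \<Rightarrow> real"
  assumes z: "\<And>i. i \<in> {1..3} \<Longrightarrow> \<bar>z i * (10 ^ 10) ^ i - box_centre i\<bar> \<le> 1 / 1000"
  obtains A :: "nat set" where "A \<subseteq> {1..}" "infinite A"
    "\<And>i. i \<in> {1..3} \<Longrightarrow> ((\<lambda>n. 1 / pochhammer (real n) i) has_sum z i) A"
proof -
  define M :: "nat \<Rightarrow> real" where "M k = 10 ^ 10 * 8 ^ k" for k
  have M: "M k \<ge> 10 ^ 10" for k by (simp add: M_def)
  have M_Suc: "M (Suc k) = 8 * M k" for k by (simp add: M_def)
  have M_mono: "M k \<le> M l" if "k \<le> l" for k l
    using that by (simp add: M_def power_increasing)
  define P where "P k y \<longleftrightarrow> (\<forall>i\<in>{1..3}. \<bar>y i * M k ^ i - box_centre i\<bar> \<le> 1 / 1000)" for k y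
  define block where "block k S \<longleftrightarrow> finite S \<and> S \<noteq> {} \<and> (\<forall>n\<in>S. M k / 4 < real n \<and> real n \<le> 2 * M k)"
    for k S
  have step: "\<exists>y'. P (Suc k) y' \<and> (\<exists>S. block k S \<and> y' = (\<lambda>i. y i - (\<Sum>n\<in>S. 1 / pochhammer (real n) i)))"
    if y: "P k y" for k y
  proof -
    obtain S where "finite S" "S \<noteq> {}" "\<And>n. n \<in> S \<Longrightarrow> M k / 4 < real n \<and> real n \<le> 2 * M k"
      and "\<And>i. i \<in> {1..3} \<Longrightarrow>
        \<bar>(y i - (\<Sum>n\<in>S. 1 / pochhammer (real n) i)) * (8 * M k) ^ i - box_centre i\<bar> \<le> 1 / 1000"
      using block_step[OF M[of k], of y] y unfolding P_def by blast
    then have "block k S" "P (Suc k) (\<lambda>i. y i - (\<Sum>n\<in>S. 1 / pochhammer (real n) i))"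
      unfolding block_def P_def M_Suc by auto
    then show ?thesis by blast
  qed
  have "P 0 z" using z by (simp add: P_def M_def)
  define R where "R k y y' \<longleftrightarrow> (\<exists>S. block k S \<and> y' = (\<lambda>i. y i - (\<Sum>n\<in>S. 1 / pochhammer (real n) i)))"
    for k and y y' :: "nat \<Rightarrow> real"
  have "\<exists>y. \<forall>k. (P k (y k) \<and> (k = 0 \<longrightarrow> y k = z)) \<and> R k (y k) (y (Suc k))"
  proof (rule dependent_nat_choice)
    show "\<exists>y. P 0 y \<and> (0 = (0::nat) \<longrightarrow> y = z)" using \<open>P 0 z\<close> by blast
    show "\<exists>y'. (P (Suc k) y' \<and> (Suc k = 0 \<longrightarrow> y' = z)) \<and> R k y y'" if "P k y \<and> (k = 0 \<longrightarrow> y = z)" for y k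
      using step that unfolding R_def by blast
  qed
  then obtain y where y: "\<And>k. P k (y k)" "y 0 = z" and R: "\<And>k. R k (y k) (y (Suc k))"
    by blast
  from R obtain S where S: "\<And>k. block k (S k)"
    and y_Suc: "\<And>k. y (Suc k) = (\<lambda>i. y k i - (\<Sum>n\<in>S k. 1 / pochhammer (real n) i))"
    unfolding R_def by metis
  define F where "F k = (\<Union>j<k. S j)" for k
  have fin: "finite (F k)" for k using S by (auto simp: F_def block_def)
  have F_Suc: "F (Suc k) = F k \<union> S k" for k by (auto simp: F_def lessThan_Suc)
  have mono: "incseq F" by (intro incseq_SucI) (auto simp: F_Suc)
  have F_le: "real n \<le> M k / 4" if n: "n \<in> F k" for n k
  proof -
    obtain j where j: "j < k" "n \<in> S j" using n by (auto simp: F_def)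
    have "real n \<le> M (Suc j) / 4" using S[of j] j(2) by (auto simp: block_def M_Suc)
    also have "\<dots> \<le> M k / 4" using M_mono[of "Suc j" k] j(1) by simp
    finally show ?thesis .
  qed
  have disj: "F k \<inter> S k = {}" for k
    using F_le S[of k] unfolding block_def by fastforce
  have F_sum: "(\<Sum>n\<in>F k. 1 / pochhammer (real n) i) = z i - y k i" for k i
  proof (induction k)
    case 0
    then show ?case by (simp add: F_def y)
  next
    case (Suc k)
    have "finite (S k)" using S by (simp add: block_def)
    then show ?case
      unfolding F_Suc using Suc by (simp add: sum.union_disjoint[OF fin _ disj] y_Suc)
  qed
  show thesis
  proof (rule that[of "\<Union>k. F k"])
    show "(\<Union>k. F k) \<subseteq> {1..}"
    proof
      fix n assume "n \<in> (\<Union>k. F k)"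
      then obtain k where "M k / 4 < real n" using S by (auto simp: F_def block_def)
      with M[of k] show "n \<in> {1..}" by (cases n) auto
    qed
    show "infinite (\<Union>k. F k)"
    proof
      assume "finite (\<Union>k. F k)"
      then obtain b where b: "\<And>n. n \<in> (\<Union>k. F k) \<Longrightarrow> n \<le> b" by (meson finite_nat_set_iff_bounded_le)
      obtain k where k: "real b < 8 ^ k" using real_arch_pow[of 8 "real b"] by auto
      obtain n where n: "n \<in> S k" using S[of k] by (auto simp: block_def)
      then have "n \<le> b" by (intro b) (auto simp: F_def)
      moreover have "M k / 4 < real n" using S n by (auto simp: block_def)
      ultimately show False using k by (simp add: M_def)
    qed
    fix i :: nat assume i: "i \<in> {1..3}"
    have "(\<lambda>k. y k i) \<longlonglongrightarrow> 0"
    proof (rule Lim_null_comparison)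
      have bound: "\<bar>y k i\<bar> \<le> (\<bar>box_centre i\<bar> + 1) * (1 / 8) ^ k" for k
      proof -
        have "(8::real) ^ k \<le> M k" by (simp add: M_def)
        also have "\<dots> = M k ^ 1" by simp
        also have "\<dots> \<le> M k ^ i" using M[of k] i by (intro power_increasing) auto
        finally have "\<bar>y k i\<bar> * 8 ^ k \<le> \<bar>y k i\<bar> * M k ^ i" by (intro mult_left_mono) auto
        also have "\<dots> = \<bar>y k i * M k ^ i\<bar>" using M[of k] by (simp add: abs_mult)
        also have "\<dots> \<le> \<bar>box_centre i\<bar> + 1" using bspec[OF y(1)[of k, unfolded P_def] i] by linarith
        finally show ?thesis by (simp add: field_simps)
      qed
      then show "\<forall>\<^sub>F k in sequentially. norm (y k i) \<le> (\<bar>box_centre i\<bar> + 1) * (1 / 8) ^ k" by simp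
      show "(\<lambda>k. (\<bar>box_centre i\<bar> + 1) * (1 / 8) ^ k) \<longlonglongrightarrow> 0"
        by (intro tendsto_mult_right_zero LIMSEQ_realpow_zero) auto
    qed
    then have "(\<lambda>k. z i - y k i) \<longlonglongrightarrow> z i - 0" by (intro tendsto_intros)
    then have "(\<lambda>k. \<Sum>n\<in>F k. 1 / pochhammer (real n) i) \<longlonglongrightarrow> z i" unfolding F_sum by simp
    then show "((\<lambda>n. 1 / pochhammer (real n) i) has_sum z i) (\<Union>k. F k)"
      by (rule has_sum_nonneg_exhaustion[OF _ fin mono, rotated]) (simp add: pochhammer_of_nat)
  qed
qed

section \<open>Back to the original sums\<close>

theorem theorem1:
  shows "interior {vector [\<Sum>\<^sub>\<infinity>n\<in>A. 1 / real n,
                            \<Sum>\<^sub>\<infinity>n\<in>A. 1 / real (n + 1),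
                            \<Sum>\<^sub>\<infinity>n\<in>A. 1 / real (n + 2)] :: real ^ 3 | A :: nat set.
                   A \<subseteq> {1..} \<and> infinite A \<and> (\<lambda>n. 1 / real n) summable_on A} \<noteq> {}"
    (is "interior ?E \<noteq> {}")
proof -
  define M :: real where "M = 10 ^ 10"
  \<comment> \<open>The finite differences of orders 0, 1, 2 of \<open>n \<mapsto> 1/n\<close> are \<open>1/n\<close>, \<open>- 1/(n (n + 1))\<close> and
    \<open>2/(n (n + 1) (n + 2))\<close>; hence the linear change of coordinates from the three given sums.\<close>
  define \<zeta> :: "real ^ 3 \<Rightarrow> nat \<Rightarrow> real" where
    "\<zeta> x i = (if i = 1 then x $ 1 else if i = 2 then x $ 1 - x $ 2 else (x $ 1 - 2 * x $ 2 + x $ 3) / 2)"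
    for x i
  define U where "U = {x. \<forall>i\<in>{1..3}. \<bar>\<zeta> x i * M ^ i - box_centre i\<bar> < 1 / 1000}"
  have U_Int: "U = (\<Inter>i\<in>{1..3}. {x. \<bar>\<zeta> x i * M ^ i - box_centre i\<bar> < 1 / 1000})"
    by (auto simp: U_def)
  have cont: "continuous_on UNIV (\<lambda>x. \<zeta> x i)" for i
    unfolding \<zeta>_def by (cases "i = 1"; cases "i = 2") (auto intro!: continuous_intros)
  have "open U"
    unfolding U_Int by (intro open_INT ballI open_Collect_less continuous_intros cont) auto
  moreover have "U \<subseteq> ?E"
  proof
    fix x assume "x \<in> U"
    then have "\<bar>\<zeta> x i * (10 ^ 10) ^ i - box_centre i\<bar> \<le> 1 / 1000" if "i \<in> {1..3}" for i
      using that unfolding U_def M_def by (simp add: less_imp_le)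
    then obtain A where A: "A \<subseteq> {1..}" "infinite A"
      and sums: "\<And>i. i \<in> {1..3} \<Longrightarrow> ((\<lambda>n. 1 / pochhammer (real n) i) has_sum \<zeta> x i) A"
      using box_attained[of "\<zeta> x"] by blast
    have s1: "((\<lambda>n. 1 / real n) has_sum x $ 1) A"
      using sums[of 1] by (simp add: \<zeta>_def)
    have s2: "((\<lambda>n. 1 / (real n * (real n + 1))) has_sum x $ 1 - x $ 2) A"
      using sums[of 2] by (simp add: \<zeta>_def eval_nat_numeral pochhammer_Suc)
    have s3: "((\<lambda>n. 1 / (real n * (real n + 1) * (real n + 2))) has_sum (x $ 1 - 2 * x $ 2 + x $ 3) / 2) A"
      using sums[of 3] by (simp add: \<zeta>_def numeral_3_eq_3 pochhammer_Suc)
    have pos: "0 < real n" if "n \<in> A" for n using A that by force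
    have t2: "((\<lambda>n. 1 / real (n + 1)) has_sum x $ 2) A"
    proof -
      have "((\<lambda>n. 1 / real n + - 1 * (1 / (real n * (real n + 1)))) has_sum x $ 1 + - 1 * (x $ 1 - x $ 2)) A"
        (is "(?f has_sum ?s) A")
        by (intro has_sum_add has_sum_cmult_right s1 s2)
      also have "?s = x $ 2" by simp
      also have "(?f has_sum x $ 2) A \<longleftrightarrow> ((\<lambda>n. 1 / real (n + 1)) has_sum x $ 2) A"
      proof (rule has_sum_cong)
        fix n assume "n \<in> A"
        then have "real n > 0" "real n + 1 > 0" using pos[of n] by auto
        then show "?f n = 1 / real (n + 1)" by (simp add: divide_simps)
      qed
      finally show ?thesis .
    qed
    have t3: "((\<lambda>n. 1 / real (n + 2)) has_sum x $ 3) A"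
    proof -
      have "((\<lambda>n. 2 * (1 / (real n * (real n + 1) * (real n + 2))) + - 1 * (1 / real n) + 2 * (1 / real (n + 1)))
          has_sum 2 * ((x $ 1 - 2 * x $ 2 + x $ 3) / 2) + - 1 * x $ 1 + 2 * x $ 2) A"
        (is "(?f has_sum ?s) A")
        by (intro has_sum_add has_sum_cmult_right s1 s3 t2)
      also have "?s = x $ 3" by (simp add: field_simps)
      also have "(?f has_sum x $ 3) A \<longleftrightarrow> ((\<lambda>n. 1 / real (n + 2)) has_sum x $ 3) A"
      proof (rule has_sum_cong)
        fix n assume "n \<in> A"
        then have "real n > 0" "real n + 1 > 0" "real n + 2 > 0" using pos[of n] by auto
        then show "?f n = 1 / real (n + 2)"
          by (simp add: divide_simps) (simp add: algebra_simps)
      qed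
      finally show ?thesis .
    qed
    have "x = vector [\<Sum>\<^sub>\<infinity>n\<in>A. 1 / real n, \<Sum>\<^sub>\<infinity>n\<in>A. 1 / real (n + 1), \<Sum>\<^sub>\<infinity>n\<in>A. 1 / real (n + 2)]"
      unfolding infsumI[OF s1] infsumI[OF t2] infsumI[OF t3]
      by (simp add: vec_eq_iff forall_3 vector_3)
    then show "x \<in> ?E"
      using A has_sum_imp_summable[OF s1] by blast
  qed
  moreover have "U \<noteq> {}"
  proof -
    define w where "w i = box_centre i / M ^ i" for i
    define x :: "real ^ 3" where "x = vector [w 1, w 1 - w 2, w 1 - 2 * w 2 + 2 * w 3]"
    have "\<zeta> x i = w i" if "i \<in> {1..3}" for i
      using that unfolding atLeastAtMost_1_3 by (auto simp: \<zeta>_def x_def vector_3)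
    then have "x \<in> U"
      by (auto simp: U_def w_def M_def)
    then show ?thesis by blast
  qed
  ultimately show ?thesis using interior_maximal[of U ?E] by blast
qed

end
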